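(* Let $\lambda_1,\lambda,\beta,a>0$. Let $N_1$ be a Poisson process with intensity $\lambda_1$, $N$ a Poisson process with intensity $\lambda$, and $E$ the exponential process with parameter $\beta$, all independent, and let $E_{N+a}(t)=E(N(t)+at)$. Then for all integers $k\ge0$ and $t>0$ the probability mass function of $N_1(E_{N+a}(t))$ is $$p_k^E(t)=P\{N_1(E_{N+a}(t))=k\}=e^{-\lambda t}\frac{\Gamma(k+at)}{k!}\left(\frac{\lambda_1}{\lambda_1+\beta}\right)^k\left(\frac{\beta}{\lambda_1+\beta}\right)^{at}\mathcal{E}_{1,at}^{k+at}\left(\frac{\lambda\beta t}{\lambda_1+\beta}\right),$$ and the probabilities $p_k^E(t)$, $k\ge 0$, satisfy the system of difference-differential equations $$\frac{d}{dt}p_k^E(t)=-\left(a\log\left(1+\frac{\lambda_1}{\beta}\right)+\frac{\lambda\lambda_1}{\lambda_1+\beta}\right)p_k^E(t)+\sum_{m=1}^{k}\left(\frac{\lambda_1}{\lambda_1+\beta}\right)^m\left(\frac{a}{m}+\frac{\lambda\beta}{\lambda_1+\beta}\right)p_{k-m}^E(t).$$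
   Context: The exponential process with parameter $\beta$ is the subordinator with Laplace exponent $\log(1+u/\beta)$, i.e. the Gamma process with shape parameter $1$ and rate $\beta$. The three-parameter generalized Mittag-Leffler function is $$\mathcal{E}_{\rho,\delta}^{\gamma}(z)=\sum_{k=0}^{\infty}\frac{\Gamma(\gamma+k)}{\Gamma(\gamma)}\frac{z^k}{k!\,\Gamma(\rho k+\delta)},$$ for $z,\rho,\delta,\gamma\in\mathbb{C}$ with $\mathrm{Re}(\rho),\mathrm{Re}(\delta),\mathrm{Re}(\gamma)>0$. *)

theory Defs
  imports "HOL-Probability.Probability"
begin

text \<open>
  Processes are indexed by time in \<open>[0, \<infinity>)\<close>; their values at negative times are irrelevant.
  Path properties are required only almost surely.
\<close>

definition cadlag :: "(real \<Rightarrow> real) \<Rightarrow> bool" where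
  "cadlag f \<longleftrightarrow>
     (\<forall>t\<ge>0. continuous (at_right t) f) \<and>
     (\<forall>t>0. \<exists>l. (f \<longlongrightarrow> l) (at_left t))"

locale levy_process = prob_space M
  for M :: "'w measure" +
  fixes X :: "real \<Rightarrow> 'w \<Rightarrow> real"
  assumes measurable_X: "0 \<le> t \<Longrightarrow> X t \<in> borel_measurable M"
    and X_0: "AE \<omega> in M. X 0 \<omega> = 0"
    and indep_increments:
      "0 \<le> \<tau> 0 \<Longrightarrow> incseq \<tau> \<Longrightarrow>
         indep_vars (\<lambda>_. borel) (\<lambda>i \<omega>. X (\<tau> (Suc i)) \<omega> - X (\<tau> i) \<omega>) {..<n::nat}"
    and stationary_increments:
      "0 \<le> s \<Longrightarrow> s \<le> t \<Longrightarrow>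
         distr M borel (\<lambda>\<omega>. X t \<omega> - X s \<omega>) = distr M borel (X (t - s))"
    and cadlag_paths: "AE \<omega> in M. cadlag (\<lambda>t. X t \<omega>)"

locale subordinator = levy_process M X
  for M :: "'w measure" and X :: "real \<Rightarrow> 'w \<Rightarrow> real" +
  assumes nondecreasing_paths: "AE \<omega> in M. mono_on {0..} (\<lambda>t. X t \<omega>)"

locale subordinator_with_exponent = subordinator M X
  for M :: "'w measure" and \<phi> :: "real \<Rightarrow> real" and X :: "real \<Rightarrow> 'w \<Rightarrow> real" +
  assumes laplace_exponent:
    "0 \<le> u \<Longrightarrow> 0 \<le> t \<Longrightarrow> expectation (\<lambda>\<omega>. exp (- u * X t \<omega>)) = exp (- t * \<phi> u)"

locale exponential_process =
  subordinator_with_exponent M "\<lambda>u. ln (1 + u / \<beta>)" E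
  for M :: "'w measure" and \<beta> :: real and E :: "real \<Rightarrow> 'w \<Rightarrow> real" +
  assumes rate_pos: "0 < \<beta>"

locale poisson_process = levy_process M "\<lambda>t \<omega>. real (N t \<omega>)"
  for M :: "'w measure" and lam :: real and N :: "real \<Rightarrow> 'w \<Rightarrow> nat" +
  assumes intensity_pos: "0 < lam"
    and poisson_marginals:
      "0 < t \<Longrightarrow> distr M (count_space UNIV) (N t) = measure_pmf (poisson_pmf (lam * t))"

text \<open>
  Mutual independence of finitely many processes, each regarded as a random element of
  \<open>\<real>\<^bsup>[0,\<infinity>)\<^esup>\<close> with the product \<open>\<sigma>\<close>-algebra.
\<close>

definition indep_processes :: "'w measure \<Rightarrow> (real \<Rightarrow> 'w \<Rightarrow> real) list \<Rightarrow> bool" where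
  "indep_processes M Xs \<longleftrightarrow>
     prob_space.indep_vars M (\<lambda>_. \<Pi>\<^sub>M t\<in>{0..}. borel)
       (\<lambda>i \<omega>. \<lambda>t\<in>{0..}. (Xs ! i) t \<omega>) {..<length Xs}"

definition mittag_leffler3 :: "complex \<Rightarrow> complex \<Rightarrow> complex \<Rightarrow> complex \<Rightarrow> complex" where
  "mittag_leffler3 \<rho> \<delta> \<gamma> z =
     (\<Sum>k. Gamma (\<gamma> + of_nat k) / Gamma \<gamma> * (z ^ k / (fact k * Gamma (\<rho> * of_nat k + \<delta>))))"

definition drifted_time_change ::
    "(real \<Rightarrow> 'w \<Rightarrow> real) \<Rightarrow> (real \<Rightarrow> 'w \<Rightarrow> nat) \<Rightarrow> real \<Rightarrow> real \<Rightarrow> 'w \<Rightarrow> real" where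
  "drifted_time_change E N a t \<omega> = E (real (N t \<omega>) + a * t) \<omega>"

text \<open>
  Since the paths are regular only almost surely, the events \<open>{N\<^sub>1(T(t)) = k}\<close> are in general
  measurable only for the completion of \<open>M\<close>, which agrees with \<open>M\<close> on the sets of \<open>M\<close>.
\<close>

definition subordinated_pmf ::
    "'w measure \<Rightarrow> (real \<Rightarrow> 'w \<Rightarrow> nat) \<Rightarrow> (real \<Rightarrow> 'w \<Rightarrow> real) \<Rightarrow> nat \<Rightarrow> real \<Rightarrow> real" where
  "subordinated_pmf M N\<^sub>1 T k t = measure (completion M) {\<omega> \<in> space M. N\<^sub>1 (T t \<omega>) \<omega> = k}"

end

theory Submission
  imports Defs "HOL-Complex_Analysis.Laurent_Convergence"
begin

text \<open>
  Write \<open>T\<close> for the time change. Right continuity of \<open>N\<^sub>1\<close> and independence give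
  \<open>p k t = E[e\<^bsup>-lam1 T(t)\<^esup> (lam1 T(t))\<^sup>k / k!]\<close>, so the generating function \<open>\<Sum>k. p k t x\<^sup>k\<close> is the
  Laplace transform of \<open>T(t)\<close> at \<open>lam1 (1 - x)\<close>. The law of \<open>E\<close> need not be inverted: the
  same observation applied to \<open>E(s)\<close> reads the Poisson mixtures of \<open>E(s)\<close> off the
  negative binomial series, and summing them over the values of \<open>N(t)\<close> gives the Mittag-Leffler
  formula. The Laplace transform of \<open>T(t)\<close> is \<open>exp (t \<psi>(x))\<close> with
  \<open>\<psi>(x) = lam / w - lam - a ln w\<close> and \<open>w = 1 + lam1 (1 - x) / \<beta>\<close>. Expanding \<open>\<psi>\<close> in powers of \<open>x\<close>
  makes \<open>p k t\<close> an exponential times a polynomial in \<open>t\<close>, and comparing coefficients in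
  \<open>d/dt exp (t \<psi>) = \<psi> exp (t \<psi>)\<close> gives the differential equations.
\<close>

subsection \<open>Power series\<close>

lemma eventually_abs_less_nhds_0:
  fixes r :: real
  shows "0 < r \<Longrightarrow> eventually (\<lambda>x. \<bar>x\<bar> < r) (nhds 0)"
  by (auto simp: eventually_nhds_metric dist_real_def)

text \<open>The first nonzero coefficient \<open>c N\<close> of the difference would survive
  division by \<open>x ^ N\<close>: the quotient series is 0 for small nonzero \<open>x\<close>, yet
  tends to \<open>c N\<close>.\<close>

lemma powser_sums_unique:
  fixes a b :: "nat \<Rightarrow> real"
  assumes "eventually (\<lambda>x. (\<lambda>n. a n * x ^ n) sums f x) (nhds 0)"
    and "eventually (\<lambda>x. (\<lambda>n. b n * x ^ n) sums f x) (nhds 0)"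
  shows "a = b"
proof (rule ccontr)
  assume "a \<noteq> b"
  define c where "c n = a n - b n" for n
  have "eventually (\<lambda>x. (\<lambda>n. c n * x ^ n) sums 0) (nhds 0)"
    using assms
  proof eventually_elim
    case (elim x)
    from sums_diff[OF this] show ?case by (simp add: c_def left_diff_distrib)
  qed
  then obtain r where r: "r > 0" "\<And>x. \<bar>x\<bar> < r \<Longrightarrow> (\<lambda>n. c n * x ^ n) sums 0"
    by (auto simp: eventually_nhds_metric dist_real_def)
  define N where "N = (LEAST n. c n \<noteq> 0)"
  have ex: "\<exists>n. c n \<noteq> 0" using \<open>a \<noteq> b\<close> by (auto simp: c_def)
  have N: "c N \<noteq> 0" unfolding N_def using ex by (rule LeastI_ex)
  have less: "c n = 0" if "n < N" for n
    using not_less_Least[of n "\<lambda>n. c n \<noteq> 0"] that by (auto simp: N_def)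
  have "(\<lambda>n. c (n + N) * x ^ n) sums 0" if x: "x \<noteq> 0" "norm x < r" for x
  proof -
    have "(\<lambda>n. c (n + N) * x ^ (n + N)) sums 0"
      using r(2)[of x] x less by (subst sums_iff_shift) simp
    then have "(\<lambda>n. x ^ N * (c (n + N) * x ^ n)) sums (x ^ N * 0)"
      by (simp add: power_add mult_ac)
    then show ?thesis
      using x by (subst (asm) sums_mult_iff) auto
  qed
  then have "((\<lambda>_. 0) \<longlongrightarrow> c (0 + N)) (at (0::real))"
    by (intro powser_limit_0_strong[OF r(1)]) auto
  with N show False by (simp add: tendsto_const_iff)
qed

text \<open>The composition is carried out for the complex function with the same coefficients and
  is then restricted to the real axis.\<close>

lemma exp_compose_powser_sums:
  fixes X :: "real fps" and f :: "real \<Rightarrow> real"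
  assumes f: "eventually (\<lambda>x. (\<lambda>n. fps_nth X n * x ^ n) sums f x) (nhds 0)"
    and X0: "fps_nth X 0 = 0"
  shows "eventually (\<lambda>x. (\<lambda>n. fps_nth (fps_exp t oo X) n * x ^ n) sums exp (t * f x)) (nhds 0)"
proof -
  define Y :: "complex fps" where "Y = Abs_fps (\<lambda>n. of_real (fps_nth X n))"
  have power: "fps_nth (Y ^ i) n = of_real (fps_nth (X ^ i) n)" for i n
    by (induction i arbitrary: n) (simp_all add: fps_mult_nth Y_def)
  have nth: "fps_nth (fps_exp (of_real t) oo Y) n = of_real (fps_nth (fps_exp t oo X) n)" for n
    by (simp add: fps_compose_nth power)
  obtain r where r: "r > 0" "\<And>x. \<bar>x\<bar> < r \<Longrightarrow> (\<lambda>n. fps_nth X n * x ^ n) sums f x"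
    using f by (auto simp: eventually_nhds_metric dist_real_def)
  have Y_sums: "(\<lambda>n. fps_nth Y n * of_real x ^ n) sums of_real (f x)" if "\<bar>x\<bar> < r" for x
    using sums_of_real[OF r(2)[OF that], where 'a = complex] by (simp add: Y_def)
  \<comment> \<open>Convergence is known strictly inside \<open>r\<close>; the nonzero point
    \<open>r / 2\<close> already makes the radius of convergence positive.\<close>
  have "conv_radius (fps_nth Y) \<ge> norm (complex_of_real (r / 2))"
    using Y_sums[of "r / 2"] r(1) by (intro conv_radius_geI) (auto simp: sums_iff)
  then have rad: "fps_conv_radius Y > 0"
    using r(1) by (simp add: fps_conv_radius_def) (metis ereal_less(2) half_gt_zero less_le_trans)
  have "(eval_fps Y) has_fps_expansion Y"
    using rad by (simp add: has_fps_expansion_def)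
  then have expansion: "((\<lambda>z. exp (of_real t * z)) \<circ> eval_fps Y) has_fps_expansion (fps_exp (of_real t) oo Y)"
    by (intro has_fps_expansion_compose has_fps_expansion_exp) (simp_all add: Y_def X0)
  have "eventually (\<lambda>z. z \<in> eball 0 (fps_conv_radius (fps_exp (of_real t) oo Y))) (nhds 0)"
    using expansion by (intro eventually_nhds_in_open) (auto simp: has_fps_expansion_def zero_ereal_def)
  moreover have "eventually (\<lambda>z. eval_fps (fps_exp (of_real t) oo Y) z = exp (of_real t * eval_fps Y z)) (nhds 0)"
    using expansion by (simp add: has_fps_expansion_def)
  ultimately have "eventually (\<lambda>z. (\<lambda>n. fps_nth (fps_exp (of_real t) oo Y) n * z ^ n) sums
      exp (of_real t * eval_fps Y z)) (nhds 0)"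
  proof eventually_elim
    case (elim z)
    then show ?case
      using sums_eval_fps[of z "fps_exp (of_real t) oo Y"] by simp
  qed
  then have ev: "eventually (\<lambda>x::real. (\<lambda>n. fps_nth (fps_exp (of_real t) oo Y) n * of_real x ^ n) sums
      exp (of_real t * eval_fps Y (of_real x))) (nhds 0)"
    by (rule eventually_compose_filterlim) (use tendsto_of_real[OF filterlim_ident[of "nhds (0::real)"], where 'a = complex] in simp)
  from ev eventually_abs_less_nhds_0[OF r(1)] show ?thesis
  proof eventually_elim
    case (elim x)
    have "eval_fps Y (of_real x) = of_real (f x)"
      using Y_sums[OF elim(2)] by (simp add: eval_fps_def sums_iff)
    with elim(1) have "(\<lambda>n. complex_of_real (fps_nth (fps_exp t oo X) n * x ^ n)) sums
        of_real (exp (t * f x))"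
      by (simp add: nth flip: exp_of_real of_real_mult of_real_power)
    then show ?case by (simp only: sums_of_real_iff)
  qed
qed

text \<open>The coefficient form of \<open>d/dt exp (t X) = X exp (t X)\<close>. As \<open>X\<close>
  has no constant term, \<open>X ^ i\<close> has no terms below degree \<open>i\<close>, so each
  coefficient is a polynomial in \<open>t\<close> and only a finite sum is differentiated.\<close>

lemma exp_compose_nth_has_derivative:
  fixes X :: "real fps"
  assumes X0: "fps_nth X 0 = 0"
  shows "((\<lambda>t. fps_nth (fps_exp t oo X) k) has_real_derivative
            (\<Sum>m=1..k. fps_nth X m * fps_nth (fps_exp t oo X) (k - m))) (at t)"
proof -
  \<comment> \<open>The cut-off \<open>n\<close> is left free: \<open>Suc k\<close> is used before
    differentiation lowers the degree by one, and \<open>k\<close> then serves all coefficients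
    \<open>k - m\<close> at once.\<close>
  have nth: "fps_nth (fps_exp t oo X) k = (\<Sum>i\<le>n. t ^ i / fact i * fps_nth (X ^ i) k)" if "k \<le> n" for t k n
    using that startsby_zero_power_prefix[OF X0]
    by (auto simp: fps_compose_nth intro!: sum.mono_neutral_left)
  have "((\<lambda>t. \<Sum>i\<le>Suc k. t ^ i / fact i * fps_nth (X ^ i) k) has_real_derivative
          (\<Sum>i\<le>Suc k. of_nat i * t ^ (i - 1) / fact i * fps_nth (X ^ i) k)) (at t)"
    by (intro DERIV_sum DERIV_cmult_right DERIV_cdivide) (auto intro!: derivative_eq_intros)
  also have "(\<Sum>i\<le>Suc k. of_nat i * t ^ (i - 1) / fact i * fps_nth (X ^ i) k)
      = (\<Sum>i\<le>k. t ^ i / fact i * fps_nth (X ^ Suc i) k)"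
    unfolding sum.atMost_Suc_shift by (simp add: fact_reduce del: power_Suc)
  also have "\<dots> = (\<Sum>i\<le>k. t ^ i / fact i * (\<Sum>m=1..k. fps_nth X m * fps_nth (X ^ i) (k - m)))"
    by (simp add: fps_mult_nth sum.atLeast_Suc_atMost[of 0] X0)
  also have "\<dots> = (\<Sum>m=1..k. fps_nth X m * (\<Sum>i\<le>k. t ^ i / fact i * fps_nth (X ^ i) (k - m)))"
    unfolding sum_distrib_left by (subst sum.swap) (simp add: mult_ac)
  also have "\<dots> = (\<Sum>m=1..k. fps_nth X m * fps_nth (fps_exp t oo X) (k - m))"
    by (intro sum.cong refl arg_cong2[where f = "(*)"] nth[symmetric]) auto
  finally show ?thesis
    by (simp only: nth[of k "Suc k", OF le_SucI[OF le_refl]])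
qed

text \<open>Newton's binomial series with exponent \<open>- s\<close> at \<open>- (q * x)\<close>:
  the signs cancel and the rising factorial becomes a quotient of Gamma values.\<close>

lemma negative_binomial_sums:
  fixes s q x :: real
  assumes "s > 0" "\<bar>q * x\<bar> < 1"
  shows "(\<lambda>k. Gamma (k + s) / (Gamma s * fact k) * q ^ k * x ^ k) sums (1 - q * x) powr (- s)"
proof -
  have s: "s \<notin> \<int>\<^sub>\<le>\<^sub>0"
    using assms by (auto simp: nonpos_Ints_def)
  have "(\<lambda>k. ((- s) gchoose k) * (- (q * x)) ^ k) sums (1 + - (q * x)) powr (- s)"
    by (rule gen_binomial_real) (use assms in simp)
  moreover have "((- s) gchoose k) * (- (q * x)) ^ k = Gamma (k + s) / (Gamma s * fact k) * q ^ k * x ^ k" for k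
  proof -
    have "((- s) gchoose k) * (- (q * x)) ^ k = ((-1) ^ k * (-1) ^ k) * (pochhammer s k / fact k) * (q * x) ^ k"
      by (simp add: gbinomial_pochhammer power_minus[of "q * x"])
    also have "(-1) ^ k * (-1) ^ k = (1::real)"
      by (simp flip: power_mult_distrib)
    finally show ?thesis
      by (simp add: pochhammer_Gamma[OF s] power_mult_distrib add.commute)
  qed
  ultimately show ?thesis by simp
qed

subsection \<open>Poisson mixtures and random time changes\<close>

text \<open>The Poisson probability of \<open>k\<close> as a function of the mean \<open>y\<close>,
  so that a random mean can be inserted.\<close>

definition poisson_weight :: "nat \<Rightarrow> real \<Rightarrow> real" where
  "poisson_weight k y = y ^ k / fact k * exp (- y)"

lemma poisson_weight_nonneg: "y \<ge> 0 \<Longrightarrow> poisson_weight k y \<ge> 0"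
  by (simp add: poisson_weight_def)

lemma poisson_weight_le_1:
  assumes "y \<ge> 0"
  shows "poisson_weight k y \<le> 1"
proof -
  have "(\<Sum>n\<in>{k}. inverse (fact n) * y ^ n) \<le> (\<Sum>n. inverse (fact n) * y ^ n)"
    by (rule sum_le_suminf) (use assms summable_exp[of y] in auto)
  also have "\<dots> = exp y"
    by (simp add: exp_def field_simps scaleR_conv_of_real)
  finally have "y ^ k / fact k \<le> exp y"
    by (simp add: field_simps)
  then show ?thesis
    by (simp add: poisson_weight_def exp_minus field_simps)
qed

lemma abs_poisson_weight_le_1: "y \<ge> 0 \<Longrightarrow> \<bar>poisson_weight k y\<bar> \<le> 1"
  using poisson_weight_nonneg[of y k] poisson_weight_le_1[of y k] by simp

lemma continuous_poisson_weight: "isCont (poisson_weight k) y"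
  unfolding poisson_weight_def by (intro continuous_intros) auto

lemma measurable_poisson_weight [measurable]: "poisson_weight k \<in> borel_measurable borel"
  unfolding poisson_weight_def by measurable

text \<open>The generating function of the Poisson law is a Laplace kernel in \<open>y\<close>; this
  turns generating functions of Poisson mixtures into Laplace transforms.\<close>

lemma poisson_weight_sums: "(\<lambda>k. poisson_weight k y * x ^ k) sums exp (- (1 - x) * y)"
proof -
  have "(\<lambda>k. (x * y) ^ k /\<^sub>R fact k * exp (- y)) sums (exp (x * y) * exp (- y))"
    by (intro sums_mult2 exp_converges)
  then show ?thesis
    by (simp add: poisson_weight_def scaleR_conv_of_real field_simps flip: exp_add)
qed

section \<open>Exchanging expectations with series\<close>

context prob_space
begin

lemma expectation_indicator_eq_prob:
  assumes [measurable]: "Z \<in> M \<rightarrow>\<^sub>M count_space UNIV"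
  shows "expectation (\<lambda>\<omega>. indicator {n} (Z \<omega>)) = prob {\<omega> \<in> space M. Z \<omega> = n}"
proof -
  have "expectation (\<lambda>\<omega>. indicator {n} (Z \<omega>) :: real) = expectation (indicator {\<omega> \<in> space M. Z \<omega> = n})"
    by (intro Bochner_Integration.integral_cong) (auto simp: indicator_def)
  then show ?thesis by simp
qed

text \<open>For each outcome at most one term is nonzero, and the \<open>n\<close>-th term has
  expected absolute value at most the probability that \<open>Z\<close> equals \<open>n\<close>.
  These probabilities are summable, so sum and expectation can be exchanged.\<close>

lemma expectation_countable_index_sums:
  fixes \<phi> :: "nat \<Rightarrow> 'a \<Rightarrow> real"
  assumes Z[measurable]: "Z \<in> M \<rightarrow>\<^sub>M count_space UNIV"
    and \<phi>[measurable]: "\<And>n. \<phi> n \<in> borel_measurable M"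
    and bound: "\<And>n. AE \<omega> in M. \<bar>\<phi> n \<omega>\<bar> \<le> 1"
  shows "(\<lambda>n. expectation (\<lambda>\<omega>. indicator {n} (Z \<omega>) * \<phi> n \<omega>)) sums expectation (\<lambda>\<omega>. \<phi> (Z \<omega>) \<omega>)"
proof -
  let ?f = "\<lambda>n \<omega>. indicator {n} (Z \<omega>) * \<phi> n \<omega>"
  have single: "?f n \<omega> = (if n = Z \<omega> then \<phi> (Z \<omega>) \<omega> else 0)" for n \<omega>
    by (simp add: indicator_def)
  have int: "integrable M (?f n)" for n
    by (rule integrable_const_bound[where B = 1])
       (use bound[of n] in eventually_elim, auto simp: indicator_def)
  have "summable (\<lambda>n. expectation (\<lambda>\<omega>. norm (?f n \<omega>)))"
  proof (rule summable_comparison_test')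
    show "norm (expectation (\<lambda>\<omega>. norm (?f n \<omega>))) \<le> (expectation (\<lambda>\<omega>. indicator {n} (Z \<omega>)) :: real)" for n
    proof -
      have "expectation (\<lambda>\<omega>. norm (?f n \<omega>)) \<le> expectation (\<lambda>\<omega>. indicator {n} (Z \<omega>))"
      proof (rule integral_mono_AE)
        show "integrable M (\<lambda>\<omega>. indicator {n} (Z \<omega>) :: real)"
          by (rule integrable_const_bound[where B = 1]) (auto simp: indicator_def)
        show "AE \<omega> in M. norm (?f n \<omega>) \<le> indicator {n} (Z \<omega>)"
          using bound[of n] by eventually_elim (auto simp: indicator_def)
      qed (use int in simp)
      then show ?thesis by (simp add: integral_nonneg_AE)
    qed
    have "(\<lambda>n. prob {\<omega> \<in> space M. Z \<omega> = n}) sums prob (\<Union>n. {\<omega> \<in> space M. Z \<omega> = n})"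
      by (rule finite_measure_UNION) (auto simp: disjoint_family_on_def)
    then show "summable (\<lambda>n. expectation (\<lambda>\<omega>. indicator {n} (Z \<omega>)) :: real)"
      by (simp add: sums_iff expectation_indicator_eq_prob)
  qed
  moreover have "summable (\<lambda>n. norm (?f n \<omega>))" for \<omega>
    unfolding single by (rule summable_finite[of "{Z \<omega>}"]) auto
  ultimately have "(\<lambda>n. expectation (?f n)) sums expectation (\<lambda>\<omega>. \<Sum>n. ?f n \<omega>)"
    by (intro sums_integral int) auto
  also have "(\<lambda>\<omega>. \<Sum>n. ?f n \<omega>) = (\<lambda>\<omega>. \<phi> (Z \<omega>) \<omega>)"
    unfolding single by (intro ext sums_unique[symmetric] sums_single)
  finally show ?thesis .
qed

text \<open>Conditioning on the value of \<open>Z\<close>. It serves twice: for a Poisson process at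
  a discretised random time, and for \<open>E\<close> at a time depending on
  \<open>N\<close>.\<close>

lemma expectation_independent_index_sums:
  fixes f :: "real \<Rightarrow> real"
  assumes Z[measurable]: "Z \<in> M \<rightarrow>\<^sub>M count_space (UNIV :: nat set)"
    and Y[measurable]: "\<And>n. Y n \<in> borel_measurable M"
    and f[measurable]: "f \<in> borel_measurable borel"
    and bound: "\<And>n. AE \<omega> in M. \<bar>f (Y n \<omega>)\<bar> \<le> 1"
    and indep: "\<And>n. indep_var borel (\<lambda>\<omega>. real (Z \<omega>)) borel (Y n)"
  shows "(\<lambda>n. prob {\<omega> \<in> space M. Z \<omega> = n} * expectation (\<lambda>\<omega>. f (Y n \<omega>))) sums
           expectation (\<lambda>\<omega>. f (Y (Z \<omega>) \<omega>))"
proof -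
  have "expectation (\<lambda>\<omega>. indicator {n} (Z \<omega>) * f (Y n \<omega>)) =
      prob {\<omega> \<in> space M. Z \<omega> = n} * expectation (\<lambda>\<omega>. f (Y n \<omega>))" for n
  proof -
    have "expectation (\<lambda>\<omega>. indicator {n} (Z \<omega>) * f (Y n \<omega>)) =
        expectation (\<lambda>\<omega>. indicator {n} (Z \<omega>)) * expectation (\<lambda>\<omega>. f (Y n \<omega>))"
    proof (rule indep_var_lebesgue_integral)
      show "indep_var borel (\<lambda>\<omega>. indicator {n} (Z \<omega>) :: real) borel (\<lambda>\<omega>. f (Y n \<omega>))"
        using indep_var_compose[OF indep[of n], of "indicator {real n}" borel f borel]
        by (simp add: o_def indicator_def)
      show "integrable M (\<lambda>\<omega>. indicator {n} (Z \<omega>) :: real)"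
        by (rule integrable_const_bound[where B = 1]) (auto simp: indicator_def)
      show "integrable M (\<lambda>\<omega>. f (Y n \<omega>))"
        by (rule integrable_const_bound[where B = 1]) (use bound in auto)
    qed
    then show ?thesis by (simp add: expectation_indicator_eq_prob)
  qed
  then show ?thesis
    using expectation_countable_index_sums[of Z "\<lambda>n \<omega>. f (Y n \<omega>)"] bound by simp
qed

text \<open>Integrates \<open>poisson_weight_sums\<close> term by term; the weights are at most 1,
  so a geometric series in \<open>\<bar>x\<bar>\<close> dominates.\<close>

lemma expectation_poisson_weight_sums:
  assumes X[measurable]: "X \<in> borel_measurable M" and nonneg: "AE \<omega> in M. X \<omega> \<ge> 0"
    and c: "c \<ge> 0" and x: "\<bar>x\<bar> < 1"
  shows "(\<lambda>k. expectation (\<lambda>\<omega>. poisson_weight k (c * X \<omega>)) * x ^ k) sums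
           expectation (\<lambda>\<omega>. exp (- (c * (1 - x)) * X \<omega>))"
proof -
  let ?f = "\<lambda>k \<omega>. poisson_weight k (c * X \<omega>) * x ^ k"
  have bound: "AE \<omega> in M. \<bar>?f k \<omega>\<bar> \<le> \<bar>x\<bar> ^ k" for k
    using nonneg
    by eventually_elim (use c in \<open>auto simp: abs_mult power_abs intro!: mult_left_le_one_le abs_poisson_weight_le_1\<close>)
  have int: "integrable M (?f k)" for k
    by (rule integrable_const_bound[where B = "\<bar>x\<bar> ^ k"]) (use bound in auto)
  have "(\<lambda>k. expectation (?f k)) sums expectation (\<lambda>\<omega>. \<Sum>k. ?f k \<omega>)"
  proof (rule sums_integral[OF int])
    have "AE \<omega> in M. \<forall>k. \<bar>?f k \<omega>\<bar> \<le> \<bar>x\<bar> ^ k"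
      using bound unfolding AE_all_countable by blast
    then show "AE \<omega> in M. summable (\<lambda>k. norm (?f k \<omega>))"
      by eventually_elim
         (rule summable_comparison_test'[OF summable_geometric[of "\<bar>x\<bar>"]], use x in auto)
    show "summable (\<lambda>k. expectation (\<lambda>\<omega>. norm (?f k \<omega>)))"
    proof (rule summable_comparison_test'[OF summable_geometric[of "\<bar>x\<bar>"]])
      show "norm (expectation (\<lambda>\<omega>. norm (?f k \<omega>))) \<le> \<bar>x\<bar> ^ k" for k
      proof -
        have "expectation (\<lambda>\<omega>. norm (?f k \<omega>)) \<le> expectation (\<lambda>\<omega>. \<bar>x\<bar> ^ k)"
          by (rule integral_mono_AE) (use int bound in auto)
        then show ?thesis by (simp add: integral_nonneg_AE prob_space)
      qed
    qed (use x in auto)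
  qed
  also have "(\<lambda>k. expectation (?f k)) = (\<lambda>k. expectation (\<lambda>\<omega>. poisson_weight k (c * X \<omega>)) * x ^ k)"
    by simp
  also have "(\<lambda>\<omega>. \<Sum>k. ?f k \<omega>) = (\<lambda>\<omega>. exp (- (1 - x) * (c * X \<omega>)))"
    by (intro ext sums_unique[symmetric] poisson_weight_sums)
  also have "\<dots> = (\<lambda>\<omega>. exp (- (c * (1 - x)) * X \<omega>))"
    by (intro ext) (simp add: algebra_simps)
  finally show ?thesis .
qed

end

section \<open>Poisson processes observed at random times\<close>

lemma (in poisson_process) measurable_N: "0 \<le> t \<Longrightarrow> N t \<in> M \<rightarrow>\<^sub>M count_space UNIV"
proof -
  assume "0 \<le> t"
  note [measurable] = measurable_X[OF this]
  have "(\<lambda>\<omega>. nat \<lfloor>real (N t \<omega>)\<rfloor>) \<in> M \<rightarrow>\<^sub>M count_space UNIV"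
    by measurable
  then show ?thesis by simp
qed

lemma (in poisson_process) prob_N:
  assumes "0 < t"
  shows "prob {\<omega> \<in> space M. N t \<omega> = k} = poisson_weight k (lam * t)"
proof -
  have [measurable]: "N t \<in> M \<rightarrow>\<^sub>M count_space UNIV"
    using assms by (intro measurable_N) simp
  have "prob {\<omega> \<in> space M. N t \<omega> = k} = measure (distr M (count_space UNIV) (N t)) {k}"
    by (subst measure_distr) (simp_all add: vimage_def Int_def conj_commute)
  also have "\<dots> = pmf (poisson_pmf (lam * t)) k"
    using poisson_marginals[OF assms] by (simp add: pmf.rep_eq)
  finally show ?thesis
    using assms intensity_pos by (simp add: poisson_weight_def)
qed

text \<open>
  The numerator is \<open>\<lfloor>r x\<rfloor> + 1\<close> rather than \<open>\<lceil>r x\<rceil>\<close> so that the approximation is strictly above \<open>x\<close>.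
\<close>

lemma filterlim_grid_above:
  fixes x :: real
  assumes "x \<ge> 0"
  shows "filterlim (\<lambda>n. (real (nat \<lfloor>real (Suc n) * x\<rfloor>) + 1) / real (Suc n)) (at_right x) sequentially"
proof -
  let ?d = "\<lambda>n. (real (nat \<lfloor>real (Suc n) * x\<rfloor>) + 1) / real (Suc n)"
  have eq: "real (nat \<lfloor>real (Suc n) * x\<rfloor>) = of_int \<lfloor>real (Suc n) * x\<rfloor>" for n
    using assms by simp
  have lower: "x < ?d n" for n
    unfolding eq by (simp add: pos_less_divide_eq mult.commute)
  have upper: "?d n \<le> x + inverse (real (Suc n))" for n
  proof -
    have "?d n \<le> (real (Suc n) * x + 1) / real (Suc n)"
      unfolding eq by (intro divide_right_mono add_right_mono of_int_floor_le) simp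
    also have "\<dots> = x + inverse (real (Suc n))"
      by (simp add: add_divide_distrib inverse_eq_divide)
    finally show ?thesis .
  qed
  have "(\<lambda>n. x + inverse (real (Suc n))) \<longlonglongrightarrow> x"
    using tendsto_add[OF tendsto_const[of x] LIMSEQ_inverse_real_of_nat] by simp
  then have "?d \<longlonglongrightarrow> x"
    by (rule tendsto_sandwich[OF always_eventually always_eventually tendsto_const, rotated 2])
       (intro allI less_imp_le lower, intro allI upper)
  then show ?thesis
    unfolding filterlim_at
    by (intro conjI always_eventually allI greaterThan_iff[THEN iffD2] lower lower[THEN less_imp_neq, THEN not_sym])
qed

text \<open>\<open>T\<close> is replaced by a grid point strictly above it. The grid is countable,
  so conditioning proves the formula for the rounded time. As the mesh shrinks, right continuity of
  the paths and continuity of the Poisson weight give the limits, both dominated by 1.\<close>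

lemma (in poisson_process) time_changed_pmf:
  assumes T[measurable]: "T \<in> borel_measurable M" and nonneg: "AE \<omega> in M. T \<omega> \<ge> 0"
    and indep: "\<And>s. s \<ge> 0 \<Longrightarrow> indep_var borel T borel (\<lambda>\<omega>. real (N s \<omega>))"
  shows "measure (completion M) {\<omega> \<in> space M. N (T \<omega>) \<omega> = k} =
           expectation (\<lambda>\<omega>. poisson_weight k (lam * T \<omega>))"
proof -
  define Z where "Z n \<omega> = nat \<lfloor>real (Suc n) * T \<omega>\<rfloor>" for n \<omega>
  define s where "s n j = (real j + 1) / real (Suc n)" for n j
  have Z[measurable]: "Z n \<in> M \<rightarrow>\<^sub>M count_space UNIV" for n
    unfolding Z_def[abs_def] by measurable
  have s_pos: "s n j > 0" for n j
    by (simp add: s_def)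
  have N_s[measurable]: "N (s n j) \<in> M \<rightarrow>\<^sub>M count_space UNIV" for n j
    by (intro measurable_N less_imp_le s_pos)
  have [measurable]: "(\<lambda>\<omega>. N (s n (Z n \<omega>)) \<omega>) \<in> M \<rightarrow>\<^sub>M count_space UNIV" for n
    by (rule measurable_compose_countable[OF N_s Z])
  \<comment> \<open>Both expectations are sums of one series over the grid index \<open>j\<close>,
    since \<open>N\<close> at the fixed time \<open>s n j\<close> is Poisson with mean
    \<open>lam * s n j\<close>.\<close>
  have approx: "expectation (\<lambda>\<omega>. indicator {k} (N (s n (Z n \<omega>)) \<omega>) :: real) =
      expectation (\<lambda>\<omega>. poisson_weight k (lam * s n (Z n \<omega>)))" for n
  proof (rule sums_unique2)
    have "(\<lambda>j. prob {\<omega> \<in> space M. Z n \<omega> = j} * expectation (\<lambda>\<omega>. indicator {real k} (real (N (s n j) \<omega>)))) sums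
        expectation (\<lambda>\<omega>. indicator {real k} (real (N (s n (Z n \<omega>)) \<omega>)))"
    proof (rule expectation_independent_index_sums[OF Z, where f = "indicator {real k}" and Y = "\<lambda>j \<omega>. real (N (s n j) \<omega>)"])
      show "indep_var borel (\<lambda>\<omega>. real (Z n \<omega>)) borel (\<lambda>\<omega>. real (N (s n j) \<omega>))" for j
        using indep_var_compose[OF indep[OF less_imp_le[OF s_pos[of n j]]],
            of "\<lambda>x. real (nat \<lfloor>real (Suc n) * x\<rfloor>)" borel id borel]
        by (simp add: o_def Z_def[abs_def])
    qed (auto simp: indicator_def)
    then show "(\<lambda>j. prob {\<omega> \<in> space M. Z n \<omega> = j} * (expectation (\<lambda>\<omega>. indicator {k} (N (s n j) \<omega>)) :: real)) sums
        expectation (\<lambda>\<omega>. indicator {k} (N (s n (Z n \<omega>)) \<omega>))"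
      by (simp add: indicator_def)
    show "(\<lambda>j. prob {\<omega> \<in> space M. Z n \<omega> = j} * (expectation (\<lambda>\<omega>. indicator {k} (N (s n j) \<omega>)) :: real)) sums
        expectation (\<lambda>\<omega>. poisson_weight k (lam * s n (Z n \<omega>)))"
      using expectation_countable_index_sums[OF Z, where \<phi> = "\<lambda>j \<omega>. poisson_weight k (lam * s n j)"]
        abs_poisson_weight_le_1[of "lam * s n _" k] s_pos intensity_pos
      by (simp add: expectation_indicator_eq_prob prob_N less_imp_le)
  qed
  \<comment> \<open>A measurable stand-in for the event that \<open>N\<close> at time
    \<open>T\<close> equals \<open>k\<close>. The two agree almost surely, so the completion gives
    them the same measure.\<close>
  define B where "B = {\<omega> \<in> space M. eventually (\<lambda>n. N (s n (Z n \<omega>)) \<omega> = k) sequentially}"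
  have B[measurable]: "B \<in> sets M"
    unfolding B_def eventually_sequentially by measurable
  have conv: "AE \<omega> in M. eventually (\<lambda>n. N (s n (Z n \<omega>)) \<omega> = N (T \<omega>) \<omega>) sequentially"
    using nonneg cadlag_paths
  proof eventually_elim
    case (elim \<omega>)
    have lim: "filterlim (\<lambda>n. s n (Z n \<omega>)) (at_right (T \<omega>)) sequentially"
      unfolding s_def Z_def using elim(1) by (rule filterlim_grid_above)
    have "((\<lambda>t. real (N t \<omega>)) \<longlongrightarrow> real (N (T \<omega>) \<omega>)) (at_right (T \<omega>))"
      using elim by (simp add: cadlag_def continuous_within)
    from filterlim_compose[OF this lim]
    \<comment> \<open>Natural numbers at distance less than 1 are equal, so convergence means
      eventual equality.\<close>
    have "eventually (\<lambda>n. dist (real (N (s n (Z n \<omega>)) \<omega>)) (real (N (T \<omega>) \<omega>)) < 1) sequentially"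
      by (rule tendstoD) simp
    then show ?case
      by eventually_elim (simp add: dist_real_def)
  qed
  have AB: "AE \<omega> in M. \<omega> \<in> B \<longleftrightarrow> \<omega> \<in> {\<omega> \<in> space M. N (T \<omega>) \<omega> = k}"
    using conv AE_space
  proof eventually_elim
    case (elim \<omega>)
    have "eventually (\<lambda>n. N (s n (Z n \<omega>)) \<omega> = k) sequentially \<longleftrightarrow>
        eventually (\<lambda>n::nat. N (T \<omega>) \<omega> = k) sequentially"
      using elim(1) by (rule eventually_cong) simp
    with elim(2) show ?case by (simp add: B_def)
  qed
  then have AB': "AE \<omega> in completion M. \<omega> \<in> B \<longleftrightarrow> \<omega> \<in> {\<omega> \<in> space M. N (T \<omega>) \<omega> = k}"
    by (rule AE_completion)
  have "measure (completion M) {\<omega> \<in> space M. N (T \<omega>) \<omega> = k} = measure (completion M) B"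
    using AB' completion.in_sets_AE[OF AB'] by (intro measure_eq_AE) auto
  also have "\<dots> = expectation (indicator B)"
    by simp
  finally have measure_eq: "measure (completion M) {\<omega> \<in> space M. N (T \<omega>) \<omega> = k} = expectation (indicator B)" .
  have "(\<lambda>n. expectation (\<lambda>\<omega>. indicator {k} (N (s n (Z n \<omega>)) \<omega>) :: real)) \<longlonglongrightarrow> expectation (indicator B)"
  proof (rule integral_dominated_convergence[where w = "\<lambda>_. 1"])
    show "AE \<omega> in M. (\<lambda>n. indicator {k} (N (s n (Z n \<omega>)) \<omega>) :: real) \<longlonglongrightarrow> indicator B \<omega>"
      using conv AB AE_space
    proof eventually_elim
      case (elim \<omega>)
      have "eventually (\<lambda>n. indicator {k} (N (s n (Z n \<omega>)) \<omega>) = (indicator B \<omega> :: real)) sequentially"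
        using elim(1) by eventually_elim (use elim(2,3) in \<open>auto simp: indicator_def\<close>)
      then show ?case by (rule tendsto_eventually)
    qed
  qed (auto simp: indicator_def)
  moreover have "(\<lambda>n. expectation (\<lambda>\<omega>. poisson_weight k (lam * s n (Z n \<omega>)))) \<longlonglongrightarrow>
      expectation (\<lambda>\<omega>. poisson_weight k (lam * T \<omega>))"
  proof (rule integral_dominated_convergence[where w = "\<lambda>_. 1"])
    show "AE \<omega> in M. (\<lambda>n. poisson_weight k (lam * s n (Z n \<omega>))) \<longlonglongrightarrow> poisson_weight k (lam * T \<omega>)"
      using nonneg
    proof eventually_elim
      case (elim \<omega>)
      have "(\<lambda>n. s n (Z n \<omega>)) \<longlonglongrightarrow> T \<omega>"
        using filterlim_grid_above[OF elim] by (simp add: filterlim_at s_def Z_def)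
      then show ?case
        by (intro isCont_tendsto_compose[OF continuous_poisson_weight] tendsto_intros)
    qed
    show "AE \<omega> in M. norm (poisson_weight k (lam * s n (Z n \<omega>))) \<le> 1" for n
      using s_pos intensity_pos by (intro AE_I2) (simp add: abs_poisson_weight_le_1 less_imp_le)
    show "(\<lambda>\<omega>. poisson_weight k (lam * s n (Z n \<omega>))) \<in> borel_measurable M" for n
      unfolding s_def by measurable
  qed auto
  ultimately show ?thesis
    unfolding approx measure_eq by (rule LIMSEQ_unique)
qed

subsection \<open>The drifted gamma time change\<close>

locale drifted_gamma_time_change =
  prob_space M + N\<^sub>1: poisson_process M lam1 N\<^sub>1 + N: poisson_process M lam N + E: exponential_process M \<beta> E
  for M :: "'w measure" and lam1 lam \<beta> a :: real
    and N\<^sub>1 N :: "real \<Rightarrow> 'w \<Rightarrow> nat" and E :: "real \<Rightarrow> 'w \<Rightarrow> real" +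
  assumes a_pos: "0 < a"
    and indep: "indep_processes M [\<lambda>t \<omega>. real (N\<^sub>1 t \<omega>), \<lambda>t \<omega>. real (N t \<omega>), E]"
begin

abbreviation T :: "real \<Rightarrow> 'w \<Rightarrow> real" where
  "T \<equiv> drifted_time_change E N a"

text \<open>The parameter of the negative binomial law of \<open>N\<^sub>1\<close> at time
  \<open>E s\<close>; \<open>1 - q\<close> is \<open>\<beta> / (lam1 + \<beta>)\<close>.\<close>

definition q :: real where
  "q = lam1 / (lam1 + \<beta>)"

lemmas positive = N\<^sub>1.intensity_pos N.intensity_pos E.rate_pos a_pos

lemma q_bounds: "0 < q" "q < 1"
  using positive by (simp_all add: q_def)

section \<open>Independence and measurability of the time change\<close>

text \<open>Independence of whole paths passes to functionals of disjoint groups of paths. Position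
  0 is \<open>N\<^sub>1\<close>, 1 is \<open>N\<close> and 2 is \<open>E\<close>.\<close>

lemma indep_functionals:
  assumes "A \<inter> B = {}" "A \<subseteq> {..<3}" "B \<subseteq> {..<3}"
    and "G \<in> borel_measurable (\<Pi>\<^sub>M i\<in>A. \<Pi>\<^sub>M t\<in>{0..}. borel)"
    and "H \<in> borel_measurable (\<Pi>\<^sub>M i\<in>B. \<Pi>\<^sub>M t\<in>{0..}. borel)"
  defines "F \<equiv> (\<lambda>i \<omega>. \<lambda>t\<in>{0..}. ([\<lambda>t \<omega>. real (N\<^sub>1 t \<omega>), \<lambda>t \<omega>. real (N t \<omega>), E] ! i) t \<omega>)"
  shows "indep_var borel (\<lambda>\<omega>. G (\<lambda>i\<in>A. F i \<omega>) :: real) borel (\<lambda>\<omega>. H (\<lambda>i\<in>B. F i \<omega>) :: real)"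
proof -
  have "indep_vars (\<lambda>_. \<Pi>\<^sub>M t\<in>{0..}. borel) F {..<3}"
    using indep by (simp add: indep_processes_def F_def numeral_3_eq_3)
  from indep_var_compose[OF indep_var_restrict[OF this assms(1-3)] assms(4,5)]
  show ?thesis by (simp add: o_def)
qed

lemma measurable_eval [measurable]:
  fixes i :: nat and t :: real
  assumes "i \<in> A" "0 \<le> t"
  shows "(\<lambda>f. f i t :: real) \<in> borel_measurable (\<Pi>\<^sub>M i\<in>A. \<Pi>\<^sub>M t\<in>{0..}. borel)"
  using assms
  by (intro measurable_compose[where f = "\<lambda>f. f i" and N = "\<Pi>\<^sub>M t\<in>{0..}. borel" and g = "\<lambda>g. g t"]
      measurable_component_singleton) auto

lemma indep_N_E:
  assumes "0 \<le> t" "0 \<le> s"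
  shows "indep_var borel (\<lambda>\<omega>. real (N t \<omega>)) borel (E s)"
  using indep_functionals[of "{1}" "{2}" "\<lambda>f. f 1 t" "\<lambda>f. f 2 s"] assms by (simp add: measurable_eval)

text \<open>\<open>T t\<close> is a measurable functional of the paths of \<open>N\<close> and
  \<open>E\<close> alone: as \<open>N t\<close> is a natural number, \<open>E\<close> is read at
  countably many fixed times.\<close>

lemma indep_T_N1:
  assumes "0 \<le> t" "0 \<le> s"
  shows "indep_var borel (T t) borel (\<lambda>\<omega>. real (N\<^sub>1 s \<omega>))"
proof -
  \<comment> \<open>The functional has to make sense for arbitrary real paths, so the value of
    \<open>N\<close> is rounded to a natural number; on actual paths this changes nothing.\<close>
  have "(\<lambda>f. f 2 (real (nat \<lfloor>f 1 t\<rfloor>) + a * t)) \<in>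
      borel_measurable (\<Pi>\<^sub>M i\<in>{1::nat, 2}. \<Pi>\<^sub>M t\<in>{0..}. (borel :: real measure))"
  proof (rule measurable_compose_countable)
    have [measurable]: "(\<lambda>f. f 1 t) \<in> borel_measurable (\<Pi>\<^sub>M i\<in>{1::nat, 2}. \<Pi>\<^sub>M t\<in>{0..}. (borel :: real measure))"
      using assms by (intro measurable_eval) auto
    show "(\<lambda>f. nat \<lfloor>f 1 t\<rfloor>) \<in> (\<Pi>\<^sub>M i\<in>{1::nat, 2}. \<Pi>\<^sub>M t\<in>{0..}. (borel :: real measure)) \<rightarrow>\<^sub>M count_space UNIV"
      by measurable
  qed (use assms a_pos in \<open>auto intro!: measurable_eval\<close>)
  from indep_functionals[OF _ _ _ this, of "{0}" "\<lambda>f. f 0 s"] assms a_pos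
  show ?thesis
    by (simp add: measurable_eval drifted_time_change_def[abs_def])
qed

lemma measurable_T [measurable]: "0 \<le> t \<Longrightarrow> T t \<in> borel_measurable M"
  using indep_var_rv1[OF indep_T_N1[of t 0]] by simp

lemma AE_E_nonneg: "AE \<omega> in M. \<forall>s\<ge>0. 0 \<le> E s \<omega>"
  using E.nondecreasing_paths E.X_0
proof eventually_elim
  case (elim \<omega>)
  show ?case
  proof (intro allI impI)
    fix s :: real assume "0 \<le> s"
    then show "0 \<le> E s \<omega>"
      using mono_onD[OF elim(1), of 0 s] elim(2) by simp
  qed
qed

lemma AE_T_nonneg:
  assumes "0 \<le> t"
  shows "AE \<omega> in M. 0 \<le> T t \<omega>"
  using AE_E_nonneg
  by eventually_elim (use assms a_pos in \<open>simp add: drifted_time_change_def\<close>)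

section \<open>Laplace transforms and Poisson mixtures\<close>

text \<open>Splits the argument of the logarithm in the exponent of \<open>E\<close> into a constant
  and the factor \<open>1 - q * x\<close>, which alone carries \<open>x\<close>.\<close>

lemma laplace_argument:
  "1 + lam1 * (1 - x) / \<beta> = (lam1 + \<beta>) / \<beta> * (1 - q * x)"
  using positive by (simp add: q_def divide_simps) (simp add: algebra_simps)

lemma abs_q_mult_less_1: "\<bar>x\<bar> < 1 \<Longrightarrow> \<bar>q * x\<bar> < 1"
  using q_bounds mult_strict_mono[of q 1 "\<bar>x\<bar>" 1] by (simp add: abs_mult)

text \<open>Near 0 both sides have the generating function
  \<open>(\<beta> / (lam1 + \<beta>)) powr s * (1 - q * x) powr (- s)\<close>, one by the Laplace
  transform of \<open>E s\<close>, the other by the negative binomial series.\<close>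

lemma expectation_poisson_weight_E:
  assumes s: "0 < s"
  shows "expectation (\<lambda>\<omega>. poisson_weight k (lam1 * E s \<omega>)) =
           (\<beta> / (lam1 + \<beta>)) powr s * (Gamma (k + s) / (Gamma s * fact k) * q ^ k)"
    (is "?l k = ?r k")
proof -
  let ?L = "\<lambda>x. expectation (\<lambda>\<omega>. exp (- (lam1 * (1 - x)) * E s \<omega>))"
  have "?l = ?r"
  proof (rule powser_sums_unique)
    show "eventually (\<lambda>x. (\<lambda>k. ?l k * x ^ k) sums ?L x) (nhds 0)"
      using eventually_abs_less_nhds_0[OF zero_less_one]
    proof eventually_elim
      case (elim x)
      have "AE \<omega> in M. 0 \<le> E s \<omega>"
        using AE_E_nonneg by eventually_elim (use s in simp)
      then show ?case
        using s elim positive by (intro expectation_poisson_weight_sums E.measurable_X) auto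
    qed
    show "eventually (\<lambda>x. (\<lambda>k. ?r k * x ^ k) sums ?L x) (nhds 0)"
      using eventually_abs_less_nhds_0[OF zero_less_one]
    proof eventually_elim
      case (elim x)
      have pos: "1 - q * x > 0" "lam1 + \<beta> > 0"
        using abs_q_mult_less_1[OF elim] positive by auto
      have "?L x = exp (- s * ln (1 + lam1 * (1 - x) / \<beta>))"
        using s elim positive by (intro E.laplace_exponent) auto
      also have "ln (1 + lam1 * (1 - x) / \<beta>) = ln (1 - q * x) - ln (\<beta> / (lam1 + \<beta>))"
        unfolding laplace_argument using pos positive by (simp add: ln_mult_pos ln_div)
      also have "exp (- s * (ln (1 - q * x) - ln (\<beta> / (lam1 + \<beta>)))) =
          (\<beta> / (lam1 + \<beta>)) powr s * (1 - q * x) powr (- s)"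
        using pos positive by (simp add: powr_def right_diff_distrib flip: exp_add)
      finally show ?case
        using sums_mult[OF negative_binomial_sums[OF s abs_q_mult_less_1[OF elim]], of "(\<beta> / (lam1 + \<beta>)) powr s"]
        by (simp add: mult.assoc)
    qed
  qed
  then show ?thesis by (rule fun_cong)
qed

text \<open>On the event that \<open>N t\<close> equals \<open>n\<close>, the time change is
  \<open>E (real n + a * t)\<close>. A bound on the half-line suffices because \<open>E\<close> is
  almost surely nonnegative; it admits Poisson weights and decaying exponentials.\<close>

lemma expectation_T_sums:
  assumes t: "0 < t" and f: "f \<in> borel_measurable borel"
    and bound: "\<And>x. 0 \<le> x \<Longrightarrow> \<bar>f x\<bar> \<le> 1"
  shows "(\<lambda>n. poisson_weight n (lam * t) * expectation (\<lambda>\<omega>. f (E (real n + a * t) \<omega>))) sums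
           expectation (\<lambda>\<omega>. f (T t \<omega>))"
proof -
  have s: "0 \<le> real n + a * t" for n
    using t a_pos by simp
  have "(\<lambda>n. prob {\<omega> \<in> space M. N t \<omega> = n} * expectation (\<lambda>\<omega>. f (E (real n + a * t) \<omega>))) sums
      expectation (\<lambda>\<omega>. f (E (real (N t \<omega>) + a * t) \<omega>))"
  proof (rule expectation_independent_index_sums[where f = f and Y = "\<lambda>n. E (real n + a * t)"])
    show "AE \<omega> in M. \<bar>f (E (real n + a * t) \<omega>)\<bar> \<le> 1" for n
      using AE_E_nonneg by eventually_elim (use s bound in auto)
  qed (use t s f in \<open>auto intro: N.measurable_N E.measurable_X indep_N_E\<close>)
  then show ?thesis
    using t by (simp add: N.prob_N drifted_time_change_def)
qed

text \<open>With \<open>w = 1 + u / \<beta>\<close>, the transform of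
  \<open>E (real n + a * t)\<close> is \<open>w powr (- (n + a * t))\<close>. Averaging over
  \<open>n\<close> evaluates the Poisson generating function at \<open>1 / w\<close>.\<close>

lemma laplace_T:
  assumes t: "0 < t" and u: "0 \<le> u"
  shows "expectation (\<lambda>\<omega>. exp (- u * T t \<omega>)) =
           exp (t * (lam / (1 + u / \<beta>) - lam - a * ln (1 + u / \<beta>)))"
proof (rule sums_unique2)
  let ?w = "1 + u / \<beta>"
  have w: "?w > 0"
    using u positive by (simp add: add_pos_nonneg)
  have "expectation (\<lambda>\<omega>. exp (- u * E (real n + a * t) \<omega>)) = (1 / ?w) ^ n * exp (- (a * t) * ln ?w)" for n
  proof -
    have "expectation (\<lambda>\<omega>. exp (- u * E (real n + a * t) \<omega>)) = exp (- (real n + a * t) * ln ?w)"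
      using t u a_pos by (intro E.laplace_exponent) auto
    also have "\<dots> = exp (- ln ?w) ^ n * exp (- (a * t) * ln ?w)"
      by (simp add: algebra_simps flip: exp_add exp_of_nat_mult)
    also have "exp (- ln ?w) = 1 / ?w"
      using w by (simp add: exp_minus inverse_eq_divide)
    finally show ?thesis .
  qed
  then show "(\<lambda>n. poisson_weight n (lam * t) * ((1 / ?w) ^ n * exp (- (a * t) * ln ?w))) sums
      expectation (\<lambda>\<omega>. exp (- u * T t \<omega>))"
    using expectation_T_sums[OF t, of "\<lambda>x. exp (- u * x)"] u by simp
  have "(\<lambda>n. poisson_weight n (lam * t) * (1 / ?w) ^ n * exp (- (a * t) * ln ?w)) sums
      (exp (- (1 - 1 / ?w) * (lam * t)) * exp (- (a * t) * ln ?w))"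
    by (intro sums_mult2 poisson_weight_sums)
  also have "exp (- (1 - 1 / ?w) * (lam * t)) * exp (- (a * t) * ln ?w) =
      exp (t * (lam / ?w - lam - a * ln ?w))"
    by (simp add: algebra_simps flip: exp_add)
  finally show "(\<lambda>n. poisson_weight n (lam * t) * ((1 / ?w) ^ n * exp (- (a * t) * ln ?w))) sums
      exp (t * (lam / ?w - lam - a * ln ?w))"
    by (simp add: mult.assoc)
qed

lemma subordinated_pmf_eq:
  assumes "0 < t"
  shows "subordinated_pmf M N\<^sub>1 T k t = expectation (\<lambda>\<omega>. poisson_weight k (lam1 * T t \<omega>))"
  unfolding subordinated_pmf_def
  using assms by (intro N\<^sub>1.time_changed_pmf measurable_T AE_T_nonneg indep_T_N1) auto

text \<open>A Poisson mixture of negative binomial laws with shapes \<open>n + a * t\<close>; this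
  series becomes the Mittag-Leffler function.\<close>

lemma subordinated_pmf_sums:
  assumes t: "0 < t"
  shows "(\<lambda>n. poisson_weight n (lam * t) * ((\<beta> / (lam1 + \<beta>)) powr (real n + a * t) *
             (Gamma (k + (real n + a * t)) / (Gamma (real n + a * t) * fact k) * q ^ k))) sums
           subordinated_pmf M N\<^sub>1 T k t"
  using expectation_T_sums[OF t, of "\<lambda>x. poisson_weight k (lam1 * x)"] t positive
  by (simp add: subordinated_pmf_eq abs_poisson_weight_le_1 expectation_poisson_weight_E add_nonneg_pos)

section \<open>Expansion of the exponent and the differential equations\<close>

text \<open>The Taylor coefficients of \<open>\<psi>\<close> at 0 in positive degrees. The constant
  term is 0 so that the exponential series can be composed with it; the omitted
  \<open>\<psi>(0)\<close> is \<open>- total_rate\<close>.\<close>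

definition jump_rates :: "real fps" where
  "jump_rates = Abs_fps (\<lambda>m. if m = 0 then 0 else q ^ m * (a / real m + lam * \<beta> / (lam1 + \<beta>)))"

definition total_rate :: real where
  "total_rate = a * ln (1 + lam1 / \<beta>) + lam * lam1 / (lam1 + \<beta>)"

lemma jump_rates_sums:
  assumes x: "\<bar>x\<bar> < 1"
  defines "w \<equiv> 1 + lam1 * (1 - x) / \<beta>"
  shows "(\<lambda>m. fps_nth jump_rates m * x ^ m) sums (total_rate + (lam / w - lam - a * ln w))"
proof -
  define b where "b = lam * \<beta> / (lam1 + \<beta>)"
  note qx = abs_q_mult_less_1[OF x]
  have pos: "1 - q * x > 0" "lam1 + \<beta> > 0"
    using qx positive by auto
  \<comment> \<open>A geometric series for \<open>lam / w\<close> and a logarithmic one for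
    \<open>- a * ln w\<close>. The last term removes the constant \<open>b\<close>; the logarithmic
    term at \<open>m = 0\<close> vanishes because division by 0 gives 0.\<close>
  have "(\<lambda>m. b * (q * x) ^ m + a * (- (- ((- (- (q * x))) ^ m) / of_nat m)) - (if m = 0 then b else 0)) sums
      (b * (1 / (1 - q * x)) + a * (- ln (1 + - (q * x))) - b)"
    using qx by (intro sums_diff sums_add sums_mult sums_minus geometric_sums ln_series' sums_single) auto
  also have "(\<lambda>m. b * (q * x) ^ m + a * (- (- ((- (- (q * x))) ^ m) / of_nat m)) - (if m = 0 then b else 0)) =
      (\<lambda>m. fps_nth jump_rates m * x ^ m)"
    by (intro ext) (simp add: jump_rates_def b_def power_mult_distrib algebra_simps)
  also have "b * (1 / (1 - q * x)) + a * (- ln (1 + - (q * x))) - b = total_rate + (lam / w - lam - a * ln w)"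
  proof -
    have "lam / w = b * (1 / (1 - q * x))"
      unfolding w_def laplace_argument b_def by simp
    moreover have "ln w = ln ((lam1 + \<beta>) / \<beta>) + ln (1 - q * x)"
      unfolding w_def laplace_argument using pos positive by (intro ln_mult_pos) auto
    moreover have "1 + lam1 / \<beta> = (lam1 + \<beta>) / \<beta>"
      using positive by (simp add: field_simps)
    moreover have "lam * lam1 / (lam1 + \<beta>) = lam - b"
      using pos by (simp add: b_def field_simps)
    ultimately show ?thesis
      by (simp add: total_rate_def algebra_simps)
  qed
  finally show ?thesis .
qed

text \<open>Both sides have the generating function \<open>exp (t \<psi>(x))\<close>; the factor
  \<open>exp (- total_rate * t)\<close> restores the constant term left out of
  \<open>jump_rates\<close>.\<close>

lemma subordinated_pmf_eq_fps:
  assumes t: "0 < t"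
  shows "subordinated_pmf M N\<^sub>1 T k t = exp (- total_rate * t) * fps_nth (fps_exp t oo jump_rates) k"
    (is "?l k = ?r k")
proof -
  let ?w = "\<lambda>x. 1 + lam1 * (1 - x) / \<beta>"
  have "eventually (\<lambda>x. (\<lambda>m. fps_nth jump_rates m * x ^ m) sums
      (total_rate + (lam / ?w x - lam - a * ln (?w x)))) (nhds 0)"
    using eventually_abs_less_nhds_0[OF zero_less_one] by eventually_elim (rule jump_rates_sums)
  then have exp_sums: "eventually (\<lambda>x. (\<lambda>m. fps_nth (fps_exp t oo jump_rates) m * x ^ m) sums
      exp (t * (total_rate + (lam / ?w x - lam - a * ln (?w x))))) (nhds 0)"
    by (rule exp_compose_powser_sums) (simp add: jump_rates_def)
  have "?l = ?r"
  proof (rule powser_sums_unique)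
    show "eventually (\<lambda>x. (\<lambda>k. ?l k * x ^ k) sums exp (t * (lam / ?w x - lam - a * ln (?w x)))) (nhds 0)"
      using eventually_abs_less_nhds_0[OF zero_less_one]
    proof eventually_elim
      case (elim x)
      have "(\<lambda>k. ?l k * x ^ k) sums expectation (\<lambda>\<omega>. exp (- (lam1 * (1 - x)) * T t \<omega>))"
        unfolding subordinated_pmf_eq[OF t] using t elim positive
        by (intro expectation_poisson_weight_sums measurable_T AE_T_nonneg) auto
      then show ?case
        using t elim positive by (subst (asm) laplace_T) auto
    qed
    show "eventually (\<lambda>x. (\<lambda>k. ?r k * x ^ k) sums exp (t * (lam / ?w x - lam - a * ln (?w x)))) (nhds 0)"
      using exp_sums
    proof eventually_elim
      case (elim x)
      from sums_mult[OF this, of "exp (- total_rate * t)"] show ?case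
        by (simp add: mult.assoc ring_distribs mult.commute[of t total_rate] flip: exp_add)
    qed
  qed
  then show ?thesis by (rule fun_cong)
qed

lemma subordinated_pmf_has_derivative:
  assumes t: "0 < t"
  shows "(subordinated_pmf M N\<^sub>1 T k has_real_derivative
            - total_rate * subordinated_pmf M N\<^sub>1 T k t
            + (\<Sum>m=1..k. q ^ m * (a / real m + lam * \<beta> / (lam1 + \<beta>)) * subordinated_pmf M N\<^sub>1 T (k - m) t)) (at t)"
    (is "(?p k has_real_derivative ?d) _")
proof -
  have "((\<lambda>t. exp (- total_rate * t) * fps_nth (fps_exp t oo jump_rates) k) has_real_derivative
      - total_rate * (exp (- total_rate * t) * fps_nth (fps_exp t oo jump_rates) k) +
      exp (- total_rate * t) * (\<Sum>m=1..k. fps_nth jump_rates m * fps_nth (fps_exp t oo jump_rates) (k - m))) (at t)"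
    by (rule derivative_eq_intros exp_compose_nth_has_derivative refl | simp add: jump_rates_def)+
  also have "- total_rate * (exp (- total_rate * t) * fps_nth (fps_exp t oo jump_rates) k) +
      exp (- total_rate * t) * (\<Sum>m=1..k. fps_nth jump_rates m * fps_nth (fps_exp t oo jump_rates) (k - m)) = ?d"
    unfolding subordinated_pmf_eq_fps[OF t] sum_distrib_left
    by (intro arg_cong2[where f = "(+)"] refl sum.cong) (simp_all add: jump_rates_def mult_ac)
  \<comment> \<open>The closed form is available for positive times, so the derivative is
    transferred on the open half-line.\<close>
  finally show ?thesis
    by (rule has_field_derivative_transform_within_open[where S = "{0<..}"])
       (use t in \<open>simp_all add: subordinated_pmf_eq_fps\<close>)
qed

section \<open>The Mittag-Leffler formula\<close>

text \<open>Regroups \<open>subordinated_pmf_sums\<close>: the \<open>n\<close>-th power of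
  \<open>\<beta> / (lam1 + \<beta>)\<close> joins \<open>(lam * t) ^ n\<close> in the argument, and
  the factors free of \<open>n\<close> form \<open>C\<close>, whose
  \<open>Gamma (real k + a * t)\<close> cancels the denominator in the Mittag-Leffler
  coefficients.\<close>

lemma subordinated_pmf_eq_mittag_leffler:
  assumes t: "0 < t"
  shows "complex_of_real (subordinated_pmf M N\<^sub>1 T k t) =
           complex_of_real
             (exp (- lam * t) * (Gamma (real k + a * t) / fact k) * q ^ k * (\<beta> / (lam1 + \<beta>)) powr (a * t))
           * mittag_leffler3 1 (complex_of_real (a * t)) (complex_of_real (real k + a * t))
               (complex_of_real (lam * \<beta> * t / (lam1 + \<beta>)))"
proof -
  define C where "C = exp (- lam * t) * (Gamma (real k + a * t) / fact k) * q ^ k * (\<beta> / (lam1 + \<beta>)) powr (a * t)"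
  define g where "g n = Gamma (real k + a * t + real n) / Gamma (real k + a * t)
      * ((lam * \<beta> * t / (lam1 + \<beta>)) ^ n / (fact n * Gamma (1 * real n + a * t)))" for n
  have G: "Gamma (real k + a * t) > 0"
    using t a_pos by (intro Gamma_real_pos) (simp add: add_nonneg_pos)
  have "C * g n = poisson_weight n (lam * t) * ((\<beta> / (lam1 + \<beta>)) powr (real n + a * t) *
             (Gamma (k + (real n + a * t)) / (Gamma (real n + a * t) * fact k) * q ^ k))" for n
  proof -
    have "(lam * \<beta> * t / (lam1 + \<beta>)) ^ n = (lam * t) ^ n * (\<beta> / (lam1 + \<beta>)) powr real n"
      using positive by (simp add: powr_realpow power_mult_distrib power_divide)
    then show ?thesis
      using G by (simp add: C_def g_def poisson_weight_def powr_add ac_simps)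
  qed
  then have "(\<lambda>n. C * g n) sums subordinated_pmf M N\<^sub>1 T k t"
    using subordinated_pmf_sums[OF t, of k] by simp
  \<comment> \<open>Dividing by \<open>C\<close> yields both convergence and the value of the real
    Mittag-Leffler series before it is moved to the complex numbers.\<close>
  moreover have C: "C \<noteq> 0"
    using G q_bounds positive by (simp add: C_def)
  ultimately have "g sums (subordinated_pmf M N\<^sub>1 T k t / C)"
    using sums_divide[of "\<lambda>n. C * g n" _ C] by simp
  then have "(\<lambda>n. complex_of_real (g n)) sums complex_of_real (subordinated_pmf M N\<^sub>1 T k t / C)"
    by (rule sums_of_real)
  also have "(\<lambda>n. complex_of_real (g n)) = (\<lambda>n. Gamma (complex_of_real (real k + a * t) + of_nat n) / Gamma (complex_of_real (real k + a * t))
      * (complex_of_real (lam * \<beta> * t / (lam1 + \<beta>)) ^ n / (fact n * Gamma (1 * of_nat n + complex_of_real (a * t)))))"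
    by (intro ext) (simp add: g_def flip: Gamma_complex_of_real)
  finally have "mittag_leffler3 1 (complex_of_real (a * t)) (complex_of_real (real k + a * t))
      (complex_of_real (lam * \<beta> * t / (lam1 + \<beta>))) = complex_of_real (subordinated_pmf M N\<^sub>1 T k t / C)"
    unfolding mittag_leffler3_def by (rule sums_unique[symmetric])
  then show ?thesis
    using C unfolding C_def[symmetric] by simp
qed

end

theorem theorem6:
  fixes M :: "'w measure"
    and N\<^sub>1 N :: "real \<Rightarrow> 'w \<Rightarrow> nat"
    and E :: "real \<Rightarrow> 'w \<Rightarrow> real"
    and lam1 lam \<beta> a :: real
    and p :: "nat \<Rightarrow> real \<Rightarrow> real"
  assumes "0 < lam1" "0 < lam" "0 < \<beta>" "0 < a"
    and "poisson_process M lam1 N\<^sub>1"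
    and "poisson_process M lam N"
    and "exponential_process M \<beta> E"
    and "indep_processes M [\<lambda>t \<omega>. real (N\<^sub>1 t \<omega>), \<lambda>t \<omega>. real (N t \<omega>), E]"
    and p_def: "p = subordinated_pmf M N\<^sub>1 (drifted_time_change E N a)"
  shows "(\<forall>k. \<forall>t>0. complex_of_real (p k t) =
           complex_of_real
             (exp (- lam * t) * (Gamma (real k + a * t) / fact k)
              * (lam1 / (lam1 + \<beta>)) ^ k * (\<beta> / (lam1 + \<beta>)) powr (a * t))
           * mittag_leffler3 1 (complex_of_real (a * t)) (complex_of_real (real k + a * t))
               (complex_of_real (lam * \<beta> * t / (lam1 + \<beta>)))) \<and>
    (\<forall>k. \<forall>t>0. (p k has_real_derivative
             (- (a * ln (1 + lam1 / \<beta>) + lam * lam1 / (lam1 + \<beta>)) * p k t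
              + (\<Sum>m = 1..k. (lam1 / (lam1 + \<beta>)) ^ m
                   * (a / real m + lam * \<beta> / (lam1 + \<beta>)) * p (k - m) t))) (at t))"
proof -
  interpret N\<^sub>1: poisson_process M lam1 N\<^sub>1 by fact
  interpret drifted_gamma_time_change M lam1 lam \<beta> a N\<^sub>1 N E
    using assms by (intro drifted_gamma_time_change.intro drifted_gamma_time_change_axioms.intro N\<^sub>1.prob_space_axioms)
  show ?thesis
    using subordinated_pmf_eq_mittag_leffler subordinated_pmf_has_derivative
    unfolding p_def q_def total_rate_def by blast
qed

end
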